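(* Consider a one-parameter canonical exponential family with mean space $J=\dot b(\Theta)=(\mu^-,\mu^+)$, and for each $a\in\{1,\dots,K\}$ let $f_a$ be a probability density on $J$ (with respect to Lebesgue measure) with $f_a(u)>0$ for all $u\in J$. Let $\mu_0^-,\mu_0^+$ be real numbers with $\mu^-<\mu_0^-<\mu_0^+<\mu^+$. Then: 1. There exist two positive constants $A$ and $B$ such that for all $x,v$ with $\mu_0^-<x<v<\mu_0^+$, all $n\ge1$ and all $a\in\{1,\dots,K\}$, $$A\,n^{-1}e^{-n\,d(x,v)}\le\pi_{a,n,x}([v,\mu^+))\le B\sqrt n\,e^{-n\,d(x,v)}.$$ 2. There exists a constant $C>0$ such that for all $x,v$ with $\mu_0^-<v\le x<\mu_0^+$, all $n\ge1$ and all $a\in\{1,\dots,K\}$, $$\pi_{a,n,x}([v,\mu^+))\ge\frac{C}{\sqrt n}.$$ The constants $A,B,C$ depend on $\mu_0^-,\mu_0^+$, $b$ and the prior densities $f_1,\dots,f_K$.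
   Context: Exponential family: $\Theta\subseteq\mathbb R$ is an open interval, $\xi$ a reference measure on $\mathbb R$, and for $\theta\in\Theta$ the distribution $\nu_\theta$ has density $f_\theta(x)=\exp(\theta x-b(\theta))$ with respect to $\xi$, where $b$ (the log-partition function) is twice differentiable and convex. The mean of $\nu_\theta$ is $\dot b(\theta)$ and its variance is $\ddot b(\theta)>0$, so $\dot b$ is one-to-one from $\Theta$ onto the open interval $J=(\mu^-,\mu^+)$ (endpoints possibly infinite). For $\mu\in J$, $\nu^\mu:=\nu_{\dot b^{-1}(\mu)}$, and $d(\mu,\mu')=\mathrm{KL}(\nu^\mu,\nu^{\mu'})$; explicitly, with $\theta=\dot b^{-1}(\mu)$ and $\theta'=\dot b^{-1}(\mu')$, $d(\mu,\mu')=\dot b(\theta)(\theta-\theta')-b(\theta)+b(\theta')$. The numbers $\mu_0^-,\mu_0^+$ are known bounds on the means $\mu_1,\dots,\mu_K$ of the $K$ arms of a bandit model with arms in this family: $\mu_0^-\le\mu_a\le\mu_0^+$ for all $a$. The density $f_a$ is the prior density on the mean of arm $a$. For an integer $n\ge1$ and $x\in J$, $\pi_{a,n,x}$ is the probability distribution on $J$ (posterior on the mean after $n$ observations with empirical mean $x$, under prior density $f_a$) with density $$\pi_{a,n,x}(u)=\frac{\exp\big(n[\dot b^{-1}(u)x-b(\dot b^{-1}(u))]\big)f_a(u)}{\int_J\exp\big(n[\dot b^{-1}(w)x-b(\dot b^{-1}(w))]\big)f_a(w)\,dw},\qquad u\in J.$$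
   Formalization: The prior densities f_a are additionally assumed bounded away from zero on every compact subset of J (as every continuous positive density is); with mere pointwise positivity the bounds can fail. *)

theory Defs
  imports "HOL-Probability.Probability"
begin

definition exp_fam :: "real measure \<Rightarrow> (real \<Rightarrow> real) \<Rightarrow> real \<Rightarrow> real measure" where
  "exp_fam \<xi> b \<theta> = density \<xi> (\<lambda>x. ennreal (exp (\<theta> * x - b \<theta>)))"

text \<open>Normalisation of the densities forces \<open>b\<close> to be the log-partition function of \<open>\<xi>\<close> on \<open>\<Theta>\<close>;
  that \<open>exp_fam \<xi> b \<theta>\<close> has mean \<open>deriv b \<theta>\<close> and variance \<open>deriv (deriv b) \<theta>\<close> is then a
  consequence, so it is not assumed.\<close>

locale exponential_family =
  fixes \<Theta> :: "real set" and \<xi> :: "real measure" and b :: "real \<Rightarrow> real"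
  assumes open_\<Theta>: "open \<Theta>" and interval_\<Theta>: "is_interval \<Theta>" and nonempty_\<Theta>: "\<Theta> \<noteq> {}"
    and sets_\<xi>: "sets \<xi> = sets borel"
    and prob_exp_fam: "\<And>\<theta>. \<theta> \<in> \<Theta> \<Longrightarrow> prob_space (exp_fam \<xi> b \<theta>)"
    and b_differentiable: "\<And>\<theta>. \<theta> \<in> \<Theta> \<Longrightarrow> b differentiable (at \<theta>)"
    and b_twice_differentiable: "\<And>\<theta>. \<theta> \<in> \<Theta> \<Longrightarrow> deriv b differentiable (at \<theta>)"
    and b_convex: "convex_on \<Theta> b"
    and b_second_deriv_pos: "\<And>\<theta>. \<theta> \<in> \<Theta> \<Longrightarrow> deriv (deriv b) \<theta> > 0"

definition mean_space :: "real set \<Rightarrow> (real \<Rightarrow> real) \<Rightarrow> real set" where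
  "mean_space \<Theta> b = deriv b ` \<Theta>"

definition mean_inf :: "real set \<Rightarrow> (real \<Rightarrow> real) \<Rightarrow> ereal" where
  "mean_inf \<Theta> b = (INF u\<in>mean_space \<Theta> b. ereal u)"

definition mean_sup :: "real set \<Rightarrow> (real \<Rightarrow> real) \<Rightarrow> ereal" where
  "mean_sup \<Theta> b = (SUP u\<in>mean_space \<Theta> b. ereal u)"

definition param_of_mean :: "real set \<Rightarrow> (real \<Rightarrow> real) \<Rightarrow> real \<Rightarrow> real" where
  "param_of_mean \<Theta> b = the_inv_into \<Theta> (deriv b)"

definition exp_fam_mean ::
    "real set \<Rightarrow> real measure \<Rightarrow> (real \<Rightarrow> real) \<Rightarrow> real \<Rightarrow> real measure" where
  "exp_fam_mean \<Theta> \<xi> b \<mu> = exp_fam \<xi> b (param_of_mean \<Theta> b \<mu>)"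

text \<open>\<open>KL_divergence b M N\<close> is the divergence of \<open>N\<close> from \<open>M\<close>, i.e. the integral with respect to
  \<open>N\<close> of the logarithm of dN/dM; hence the swapped arguments. Base \<open>exp 1\<close> gives natural logarithms.\<close>

definition mean_divergence ::
    "real set \<Rightarrow> real measure \<Rightarrow> (real \<Rightarrow> real) \<Rightarrow> real \<Rightarrow> real \<Rightarrow> real" where
  "mean_divergence \<Theta> \<xi> b \<mu> \<mu>' =
     KL_divergence (exp 1) (exp_fam_mean \<Theta> \<xi> b \<mu>') (exp_fam_mean \<Theta> \<xi> b \<mu>)"

definition prob_density_on :: "real set \<Rightarrow> (real \<Rightarrow> real) \<Rightarrow> bool" where
  "prob_density_on J f \<longleftrightarrow>
     (\<forall>u\<in>J. 0 \<le> f u) \<and> set_integrable lborel J f \<and> (LINT u:J|lborel. f u) = 1"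

definition posterior_weight ::
    "real set \<Rightarrow> (real \<Rightarrow> real) \<Rightarrow> (real \<Rightarrow> real) \<Rightarrow> nat \<Rightarrow> real \<Rightarrow> real \<Rightarrow> real" where
  "posterior_weight \<Theta> b f n x u =
     exp (real n * (param_of_mean \<Theta> b u * x - b (param_of_mean \<Theta> b u))) * f u"

definition posterior ::
    "real set \<Rightarrow> (real \<Rightarrow> real) \<Rightarrow> (real \<Rightarrow> real) \<Rightarrow> nat \<Rightarrow> real \<Rightarrow> real measure" where
  "posterior \<Theta> b f n x =
     density lborel (\<lambda>u. indicator (mean_space \<Theta> b) u *
       ennreal (posterior_weight \<Theta> b f n x u /
         (LINT w:mean_space \<Theta> b|lborel. posterior_weight \<Theta> b f n x w)))"

text \<open>A pointwise positive density can still vanish arbitrarily fast at an interior point of \<open>J\<close>,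
  and no polynomial lower bound on tail masses survives that. The priors are therefore required
  to be bounded away from zero on compact subsets of \<open>J\<close>, as every continuous positive density
  is.\<close>

definition locally_bounded_away_from_zero :: "real set \<Rightarrow> (real \<Rightarrow> real) \<Rightarrow> bool" where
  "locally_bounded_away_from_zero J f \<longleftrightarrow>
     (\<forall>S. compact S \<and> S \<subseteq> J \<longrightarrow> (\<exists>c>0. \<forall>u\<in>S. c \<le> f u))"

lemma continuous_pos_locally_bounded_away_from_zero:
  assumes "continuous_on J f" "\<And>u. u \<in> J \<Longrightarrow> 0 < f u"
  shows "locally_bounded_away_from_zero J f"
  unfolding locally_bounded_away_from_zero_def
proof (intro allI impI, elim conjE)
  fix S assume S: "compact S" "S \<subseteq> J"
  show "\<exists>c>0. \<forall>u\<in>S. c \<le> f u"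
  proof (cases "S = {}")
    case True
    then show ?thesis by (auto intro: exI[of _ 1])
  next
    case False
    then obtain s where "s \<in> S" "\<forall>u\<in>S. f s \<le> f u"
      using continuous_attains_inf[OF S(1) False continuous_on_subset[OF assms(1) S(2)]] by blast
    then show ?thesis using assms(2) S(2) by blast
  qed
qed

end

theory Submission imports Defs begin

text \<open>Write \<open>\<tau>\<close> for the inverse of \<open>b'\<close> and \<open>tilt x t = t * x - b t\<close>. The posterior weight of \<open>u\<close> is
  \<open>exp (n * tilt x (\<tau> u)) * f u\<close>; the exponent is unimodal in \<open>u\<close> with maximum at \<open>x\<close>, and
  \<open>d x v = tilt x (\<tau> x) - tilt x (\<tau> v)\<close>. Since the prior has total mass 1, integrals over
  \<open>[v, \<mu>\<^sup>+)\<close> and over \<open>J\<close> are at most the largest exponential factor. Conversely, near the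
  compact range of \<open>x\<close> and \<open>v\<close> the prior is at least some \<open>c > 0\<close> and \<open>\<tau>\<close> is Lipschitz, so the
  exponent falls by only \<open>O(1)\<close> on an interval of length of order \<open>1 / n\<close> to the right of \<open>v\<close>,
  and even on one of order \<open>1 / sqrt n\<close> to the right of the maximum \<open>x\<close>, where it decreases
  quadratically. The Lipschitz bound needs \<open>b''\<close> bounded away from 0 on compact sets, hence the
  continuity of \<open>b''\<close>, which comes from differentiating \<open>exp (b \<theta>) = \<integral>x. exp (\<theta> * x) \<partial>\<xi>\<close> under the
  integral; this also gives the mean of \<open>exp_fam \<xi> b \<theta>\<close> and thereby the formula for \<open>d\<close>.\<close>

section \<open>Elementary exponential, integral and finiteness estimates\<close>

lemma abs_exp_minus_one_le:
  fixes y :: real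
  shows "\<bar>exp y - 1\<bar> \<le> \<bar>y\<bar> * exp \<bar>y\<bar>"
proof (cases "y \<ge> 0")
  case True
  \<comment> \<open>Multiplying \<open>1 - y \<le> exp (- y)\<close> by \<open>exp y\<close> and
    rearranging gives \<open>exp y - 1 \<le> y * exp y\<close>.\<close>
  have "(1 - y) * exp y \<le> exp (- y) * exp y"
    using exp_ge_add_one_self[of "- y"] by (intro mult_right_mono) auto
  also have "\<dots> = 1" by (simp add: exp_minus)
  finally show ?thesis using True by (simp add: algebra_simps)
next
  case False
  have "1 - exp y \<le> - y" using exp_ge_add_one_self[of y] by linarith
  also have "\<dots> \<le> - y * exp (- y)"
    using False mult_left_mono[of 1 "exp (- y)" "- y"] by auto
  finally show ?thesis using False by simp
qed

text \<open>The exponential of an absolute value is one of the two summands. After multiplication by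
  \<open>exp (\<theta> * x)\<close>, the right side becomes the integrands at the shifted parameters
  \<open>\<theta> + \<delta>\<close> and \<open>\<theta> - \<delta>\<close>, which are integrable
  and free of \<open>h\<close>.\<close>

lemma exp_abs_mult_le:
  fixes h \<delta> x :: real
  assumes "\<bar>h\<bar> \<le> \<delta>"
  shows "exp \<bar>h * x\<bar> \<le> exp (\<delta> * x) + exp (- \<delta> * x)"
proof -
  have "\<bar>h * x\<bar> \<le> \<bar>\<delta> * x\<bar>"
    using assms by (auto simp: abs_mult intro!: mult_right_mono)
  then have "exp \<bar>h * x\<bar> \<le> exp \<bar>\<delta> * x\<bar>" by simp
  also have "\<dots> \<le> exp (\<delta> * x) + exp (- \<delta> * x)" by (cases "\<delta> * x \<ge> 0") auto
  finally show ?thesis .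
qed

lemma set_integral_mono_superset:
  fixes g :: "'a \<Rightarrow> real"
  assumes "set_integrable M A g" "set_integrable M B g" "A \<subseteq> B" "\<And>x. x \<in> B \<Longrightarrow> 0 \<le> g x"
  shows "(LINT x:A|M. g x) \<le> (LINT x:B|M. g x)"
  unfolding set_lebesgue_integral_def
proof (rule integral_mono)
  fix x
  show "indicator A x *\<^sub>R g x \<le> indicator B x *\<^sub>R g x"
    using assms(3,4) by (cases "x \<in> B") (auto simp: indicator_def)
qed (use assms(1,2) in \<open>simp_all add: set_integrable_def\<close>)

text \<open>Provides one lower bound for the priors of all arms, as the minimum of the individual
  ones.\<close>

lemma finite_uniform_pos_lower_bound:
  assumes "finite I" "\<And>a. a \<in> I \<Longrightarrow> \<exists>c>0. \<forall>u\<in>S. c \<le> f a u"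
  shows "\<exists>c>0::real. \<forall>a\<in>I. \<forall>u\<in>S. c \<le> f a u"
  using assms
proof (induction I rule: finite_induct)
  case empty
  then show ?case by (auto intro: exI[of _ 1])
next
  case (insert a I)
  then obtain c d where "c > 0" "\<forall>a\<in>I. \<forall>u\<in>S. c \<le> f a u" "d > 0" "\<forall>u\<in>S. d \<le> f a u"
    by blast
  then show ?case by (intro exI[of _ "min c d"]) force
qed

subsection \<open>Moments and derivatives of the log-partition function\<close>

context exponential_family
begin

lemma borel_measurable_\<xi>: "g \<in> borel_measurable borel \<Longrightarrow> g \<in> borel_measurable \<xi>"
  by (subst measurable_cong_sets[OF sets_\<xi> refl])

lemma density_has_integral:
  assumes "\<theta> \<in> \<Theta>"
  shows "integrable \<xi> (\<lambda>x. exp (\<theta> * x - b \<theta>))" "(\<integral>x. exp (\<theta> * x - b \<theta>) \<partial>\<xi>) = 1"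
proof -
  have m [measurable]: "(\<lambda>x. exp (\<theta> * x - b \<theta>)) \<in> borel_measurable \<xi>"
    by (rule borel_measurable_\<xi>) simp
  interpret prob_space "exp_fam \<xi> b \<theta>" by (rule prob_exp_fam[OF assms])
  have "(\<integral>\<^sup>+x. ennreal (exp (\<theta> * x - b \<theta>)) \<partial>\<xi>) = emeasure (exp_fam \<xi> b \<theta>) (space \<xi>)"
    unfolding exp_fam_def by (subst emeasure_density) (auto intro!: nn_integral_cong)
  also have "\<dots> = ennreal 1"
    using emeasure_space_1 by (simp add: exp_fam_def)
  finally have "has_bochner_integral \<xi> (\<lambda>x. exp (\<theta> * x - b \<theta>)) 1"
    by (intro has_bochner_integral_nn_integral) auto
  then show "integrable \<xi> (\<lambda>x. exp (\<theta> * x - b \<theta>))" "(\<integral>x. exp (\<theta> * x - b \<theta>) \<partial>\<xi>) = 1"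
    by (auto simp: has_bochner_integral_iff)
qed

text \<open>This is the \<open>k\<close>-th derivative of the Laplace transform of \<xi>. Without
  the factor \<open>exp (- b \<theta>)\<close>, differentiation in \<theta> simply raises
  \<open>k\<close> by one.\<close>

definition moment :: "nat \<Rightarrow> real \<Rightarrow> real" where
  "moment k \<theta> = (\<integral>x. x ^ k * exp (\<theta> * x) \<partial>\<xi>)"

lemma moment_0:
  assumes "\<theta> \<in> \<Theta>"
  shows "integrable \<xi> (\<lambda>x. exp (\<theta> * x))" "moment 0 \<theta> = exp (b \<theta>)"
proof -
  have eq: "exp (\<theta> * x) = exp (b \<theta>) * exp (\<theta> * x - b \<theta>)" for x
    by (simp add: exp_add[symmetric])
  show "integrable \<xi> (\<lambda>x. exp (\<theta> * x))"
    by (subst eq) (intro integrable_mult_right density_has_integral assms)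
  show "moment 0 \<theta> = exp (b \<theta>)"
    unfolding moment_def using density_has_integral[OF assms] by (subst eq) simp
qed

lemma neighbours_in_\<Theta>:
  assumes "\<theta> \<in> \<Theta>"
  obtains \<delta> where "\<delta> > 0" "\<And>h. \<bar>h\<bar> \<le> \<delta> \<Longrightarrow> \<theta> + h \<in> \<Theta>"
proof -
  obtain \<delta> where "\<delta> > 0" "cball \<theta> \<delta> \<subseteq> \<Theta>"
    using open_contains_cball[of \<Theta>] open_\<Theta> assms by blast
  then show thesis
    by (intro that[of \<delta>]) (auto simp: subset_iff dist_real_def)
qed

text \<open>Each extra factor \<open>x\<close> is paid for by a small shift of the parameter:
  \<open>\<delta> * \<bar>x\<bar>\<close> is at most
  \<open>exp (\<delta> * x) + exp (- \<delta> * x)\<close>, and \<Theta> is open, so the induction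
  hypothesis applies at both shifted parameters.\<close>

lemma moment_integrable: "\<theta> \<in> \<Theta> \<Longrightarrow> integrable \<xi> (\<lambda>x. x ^ k * exp (\<theta> * x))"
proof (induction k arbitrary: \<theta>)
  case 0
  then show ?case using moment_0 by simp
next
  case (Suc k)
  obtain \<delta> where \<delta>: "\<delta> > 0" "\<And>h. \<bar>h\<bar> \<le> \<delta> \<Longrightarrow> \<theta> + h \<in> \<Theta>"
    using neighbours_in_\<Theta>[OF Suc.prems] by blast
  \<comment> \<open>The form \<open>\<theta> + - \<delta>\<close> matches
    \<open>\<theta> + h\<close> with \<open>h = - \<delta>\<close>.\<close>
  have \<theta>: "\<theta> + \<delta> \<in> \<Theta>" "\<theta> + - \<delta> \<in> \<Theta>" using \<delta> by (intro \<delta>(2); simp)+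
  define w where "w x = x ^ k * exp ((\<theta> + \<delta>) * x)" for x
  define w' where "w' x = x ^ k * exp ((\<theta> + - \<delta>) * x)" for x
  have w: "integrable \<xi> w" "integrable \<xi> w'"
    using Suc.IH[OF \<theta>(1)] Suc.IH[OF \<theta>(2)] unfolding w_def w'_def by auto
  show ?case
  proof (rule Bochner_Integration.integrable_bound)
    show "integrable \<xi> (\<lambda>x. (\<bar>w x\<bar> + \<bar>w' x\<bar>) / \<delta>)" using w by auto
    show "(\<lambda>x. x ^ Suc k * exp (\<theta> * x)) \<in> borel_measurable \<xi>"
      by (rule borel_measurable_\<xi>) simp
    have "\<bar>x ^ Suc k * exp (\<theta> * x)\<bar> \<le> (\<bar>w x\<bar> + \<bar>w' x\<bar>) / \<delta>" for x
    proof -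
      have "\<delta> * \<bar>x\<bar> \<le> exp \<bar>\<delta> * x\<bar>"
        using exp_ge_add_one_self[of "\<bar>\<delta> * x\<bar>"] \<delta>(1) unfolding abs_mult by linarith
      also have "\<dots> \<le> exp (\<delta> * x) + exp (- \<delta> * x)"
        using \<delta>(1) by (intro exp_abs_mult_le) auto
      finally have "(\<delta> * \<bar>x\<bar>) * (\<bar>x ^ k\<bar> * exp (\<theta> * x))
          \<le> (exp (\<delta> * x) + exp (- \<delta> * x)) * (\<bar>x ^ k\<bar> * exp (\<theta> * x))"
        by (intro mult_right_mono) auto
      also have "\<dots> = \<bar>w x\<bar> + \<bar>w' x\<bar>"
        unfolding w_def w'_def by (simp add: abs_mult algebra_simps exp_add exp_diff exp_minus divide_simps)
      finally show ?thesis
        using \<delta>(1) by (simp add: abs_mult field_simps)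
    qed
    then show "AE x in \<xi>. norm (x ^ Suc k * exp (\<theta> * x)) \<le> norm ((\<bar>w x\<bar> + \<bar>w' x\<bar>) / \<delta>)"
      using \<delta>(1) by (intro AE_I2) (auto intro: order_trans)
  qed
qed

text \<open>Differentiation under the integral sign by dominated convergence. For small
  \<open>h\<close> the difference quotients are dominated by the integrands of order
  \<open>Suc k\<close> at the parameters \<open>\<theta> + \<delta>\<close> and
  \<open>\<theta> - \<delta>\<close>.\<close>

lemma moment_has_derivative:
  assumes "\<theta> \<in> \<Theta>"
  shows "(moment k has_real_derivative moment (Suc k) \<theta>) (at \<theta>)"
proof -
  obtain \<delta> where \<delta>: "\<delta> > 0" "\<And>h. \<bar>h\<bar> \<le> \<delta> \<Longrightarrow> \<theta> + h \<in> \<Theta>"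
    using neighbours_in_\<Theta>[OF assms] by blast
  have \<theta>: "\<theta> + \<delta> \<in> \<Theta>" "\<theta> + - \<delta> \<in> \<Theta>" using \<delta> by (intro \<delta>(2); simp)+
  define w where "w x = x ^ Suc k * exp ((\<theta> + \<delta>) * x)" for x
  define w' where "w' x = x ^ Suc k * exp ((\<theta> + - \<delta>) * x)" for x
  have w: "integrable \<xi> w" "integrable \<xi> w'"
    using moment_integrable[OF \<theta>(1), of "Suc k"] moment_integrable[OF \<theta>(2), of "Suc k"]
    unfolding w_def w'_def by auto
  \<comment> \<open>\<open>q h\<close> is the integrand of the difference quotient of
    \<open>moment k\<close> with increment \<open>h\<close>.\<close>
  define q where "q h x = x ^ k * exp (\<theta> * x) * ((exp (h * x) - 1) / h)" for h x
  have q_lim: "((\<lambda>h. q h x) \<longlongrightarrow> x ^ Suc k * exp (\<theta> * x)) (at 0)" for x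
  proof -
    have "((\<lambda>h. exp (h * x)) has_real_derivative x) (at 0)"
      by (auto intro!: derivative_eq_intros)
    then have "((\<lambda>h. (exp (h * x) - 1) / h) \<longlongrightarrow> x) (at 0)"
      by (simp add: DERIV_def)
    then have "((\<lambda>h. q h x) \<longlongrightarrow> x ^ k * exp (\<theta> * x) * x) (at 0)"
      unfolding q_def by (intro tendsto_intros)
    then show ?thesis by (simp add: mult_ac)
  qed
  have q_bound: "\<bar>q h x\<bar> \<le> \<bar>w x\<bar> + \<bar>w' x\<bar>" if "h \<noteq> 0" "\<bar>h\<bar> < \<delta>" for h x
  proof -
    have "\<bar>exp (h * x) - 1\<bar> \<le> \<bar>h * x\<bar> * exp \<bar>h * x\<bar>" by (rule abs_exp_minus_one_le)
    also have "\<dots> \<le> \<bar>h * x\<bar> * (exp (\<delta> * x) + exp (- \<delta> * x))"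
      using that by (intro mult_left_mono exp_abs_mult_le) auto
    finally have "\<bar>(exp (h * x) - 1) / h\<bar> \<le> \<bar>x\<bar> * (exp (\<delta> * x) + exp (- \<delta> * x))"
      using that by (simp add: abs_mult field_simps)
    then have "\<bar>q h x\<bar> \<le> \<bar>x ^ k * exp (\<theta> * x)\<bar> * (\<bar>x\<bar> * (exp (\<delta> * x) + exp (- \<delta> * x)))"
      unfolding q_def abs_mult[of "x ^ k * exp (\<theta> * x)"] by (rule mult_left_mono) simp
    also have "\<dots> = \<bar>w x\<bar> + \<bar>w' x\<bar>"
      unfolding w_def w'_def by (simp add: abs_mult algebra_simps exp_add exp_diff exp_minus divide_simps)
    finally show ?thesis .
  qed
  \<comment> \<open>Dominated convergence works along sequences. Restricting to the window makes
    \<open>q_bound\<close> hold for every term; the window is open and contains 0, so the limit is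
    the full one.\<close>
  have "((\<lambda>h. (moment k (\<theta> + h) - moment k \<theta>) / h) \<longlongrightarrow> moment (Suc k) \<theta>)
      (at 0 within {- \<delta><..<\<delta>})"
    unfolding tendsto_at_iff_sequentially
  proof (intro allI impI)
    fix X :: "nat \<Rightarrow> real"
    assume X: "\<forall>i. X i \<in> {- \<delta><..<\<delta>} - {0}" "X \<longlonglongrightarrow> 0"
    have X1: "X i \<noteq> 0" "\<bar>X i\<bar> < \<delta>" for i using spec[OF X(1), of i] by auto
    have X2: "filterlim X (at 0) sequentially"
      using X1 X(2) by (simp add: filterlim_at)
    have "(\<lambda>i. \<integral>x. q (X i) x \<partial>\<xi>) \<longlonglongrightarrow> (\<integral>x. x ^ Suc k * exp (\<theta> * x) \<partial>\<xi>)"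
    proof (rule integral_dominated_convergence)
      show "integrable \<xi> (\<lambda>x. \<bar>w x\<bar> + \<bar>w' x\<bar>)" using w by auto
      show "AE x in \<xi>. (\<lambda>i. q (X i) x) \<longlonglongrightarrow> x ^ Suc k * exp (\<theta> * x)"
        using filterlim_compose[OF q_lim X2] by auto
      show "AE x in \<xi>. norm (q (X i) x) \<le> \<bar>w x\<bar> + \<bar>w' x\<bar>" for i
        using q_bound[OF X1] by auto
      show "(\<lambda>x. x ^ Suc k * exp (\<theta> * x)) \<in> borel_measurable \<xi>"
        by (rule borel_measurable_\<xi>) simp
      show "q (X i) \<in> borel_measurable \<xi>" for i
        unfolding q_def by (rule borel_measurable_\<xi>) simp
    qed
    moreover have "(\<integral>x. q (X i) x \<partial>\<xi>) = (moment k (\<theta> + X i) - moment k \<theta>) / X i" for i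
    proof -
      have "\<theta> + X i \<in> \<Theta>" using X1[of i] by (intro \<delta>(2)) auto
      then have "(\<integral>x. (x ^ k * exp ((\<theta> + X i) * x) - x ^ k * exp (\<theta> * x)) / X i \<partial>\<xi>)
          = (moment k (\<theta> + X i) - moment k \<theta>) / X i"
        unfolding moment_def using moment_integrable assms by simp
      moreover have "q (X i) = (\<lambda>x. (x ^ k * exp ((\<theta> + X i) * x) - x ^ k * exp (\<theta> * x)) / X i)"
        using X1[of i] by (auto simp: q_def fun_eq_iff field_simps exp_add)
      ultimately show ?thesis by simp
    qed
    ultimately show "((\<lambda>h. (moment k (\<theta> + h) - moment k \<theta>) / h) \<circ> X) \<longlonglongrightarrow> moment (Suc k) \<theta>"
      unfolding moment_def by (simp add: comp_def)
  qed
  then have "((\<lambda>h. (moment k (\<theta> + h) - moment k \<theta>) / h) \<longlongrightarrow> moment (Suc k) \<theta>) (at 0)"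
    using \<delta>(1) by (subst (asm) at_within_open) auto
  then show ?thesis by (simp add: DERIV_def)
qed

lemma b_has_derivative: "\<theta> \<in> \<Theta> \<Longrightarrow> (b has_real_derivative deriv b \<theta>) (at \<theta>)"
  using b_differentiable DERIV_deriv_iff_real_differentiable by blast

lemma deriv_b_has_derivative:
  "\<theta> \<in> \<Theta> \<Longrightarrow> (deriv b has_real_derivative deriv (deriv b) \<theta>) (at \<theta>)"
  using b_twice_differentiable DERIV_deriv_iff_real_differentiable by blast

text \<open>On the open set \<Theta>, \<open>moment 0\<close> coincides with
  \<open>exp (b \<theta>)\<close>, so its derivative can be computed in two ways. Divided by
  \<open>exp (b \<theta>)\<close>, this says that the mean is
  \<open>deriv b \<theta>\<close>.\<close>

lemma moment_1:
  assumes "\<theta> \<in> \<Theta>"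
  shows "moment 1 \<theta> = exp (b \<theta>) * deriv b \<theta>"
proof -
  have "((\<lambda>\<theta>. exp (b \<theta>)) has_real_derivative exp (b \<theta>) * deriv b \<theta>) (at \<theta>)"
    by (auto intro!: derivative_eq_intros b_has_derivative assms)
  moreover have "((\<lambda>\<theta>. exp (b \<theta>)) has_real_derivative moment 1 \<theta>) (at \<theta>)"
  proof (rule has_field_derivative_transform_within_open[OF _ open_\<Theta> assms])
    show "(moment 0 has_real_derivative moment 1 \<theta>) (at \<theta>)"
      using moment_has_derivative[OF assms, of 0] by (simp add: numeral_2_eq_2)
  qed (simp add: moment_0)
  ultimately show ?thesis by (rule DERIV_unique[rotated])
qed

text \<open>The same comparison of derivatives, one order higher. It expresses the second derivative
  of \<open>b\<close> through quantities known to be continuous.\<close>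

lemma moment_2:
  assumes "\<theta> \<in> \<Theta>"
  shows "moment 2 \<theta> = exp (b \<theta>) * ((deriv b \<theta>)\<^sup>2 + deriv (deriv b) \<theta>)"
proof -
  have "((\<lambda>\<theta>. exp (b \<theta>) * deriv b \<theta>) has_real_derivative
      exp (b \<theta>) * ((deriv b \<theta>)\<^sup>2 + deriv (deriv b) \<theta>)) (at \<theta>)"
    by (auto intro!: derivative_eq_intros b_has_derivative deriv_b_has_derivative assms
        simp: algebra_simps power2_eq_square)
  moreover have "((\<lambda>\<theta>. exp (b \<theta>) * deriv b \<theta>) has_real_derivative moment 2 \<theta>) (at \<theta>)"
  proof (rule has_field_derivative_transform_within_open[OF _ open_\<Theta> assms])
    show "(moment 1 has_real_derivative moment 2 \<theta>) (at \<theta>)"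
      using moment_has_derivative[OF assms, of 1] by (simp add: numeral_2_eq_2)
  qed (rule moment_1)
  ultimately show ?thesis by (rule DERIV_unique[rotated])
qed

lemma continuous_on_moment: "continuous_on \<Theta> (moment k)"
  using moment_has_derivative by (meson DERIV_isCont continuous_at_imp_continuous_on)

lemma continuous_on_deriv_b: "continuous_on \<Theta> (deriv b)"
  using deriv_b_has_derivative by (meson DERIV_isCont continuous_at_imp_continuous_on)

lemma continuous_on_b: "continuous_on \<Theta> b"
  using b_has_derivative by (meson DERIV_isCont continuous_at_imp_continuous_on)

lemma continuous_on_deriv_deriv_b: "continuous_on \<Theta> (deriv (deriv b))"
proof -
  have "continuous_on \<Theta> (\<lambda>\<theta>. moment 2 \<theta> / exp (b \<theta>) - (deriv b \<theta>)\<^sup>2)"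
    by (intro continuous_intros continuous_on_moment continuous_on_deriv_b continuous_on_b) auto
  then show ?thesis
    by (rule continuous_on_eq) (simp add: moment_2)
qed

subsection \<open>The mean parametrisation\<close>

abbreviation "J \<equiv> mean_space \<Theta> b"
abbreviation "\<tau> \<equiv> param_of_mean \<Theta> b"

definition tilt :: "real \<Rightarrow> real \<Rightarrow> real" where
  "tilt x t = t * x - b t"

lemma in_\<Theta>_between:
  assumes "s \<in> \<Theta>" "t \<in> \<Theta>" "s \<le> z" "z \<le> t"
  shows "z \<in> \<Theta>"
  using interval_\<Theta> assms unfolding is_interval_1 by blast

lemma deriv_b_strict_mono:
  assumes "s \<in> \<Theta>" "t \<in> \<Theta>" "s < t"
  shows "deriv b s < deriv b t"
proof (rule DERIV_pos_imp_increasing[OF \<open>s < t\<close>])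
  fix z assume "s \<le> z" "z \<le> t"
  then have "z \<in> \<Theta>" using in_\<Theta>_between assms by blast
  then show "\<exists>y. (deriv b has_real_derivative y) (at z) \<and> 0 < y"
    using deriv_b_has_derivative b_second_deriv_pos by blast
qed

lemma inj_on_deriv_b: "inj_on (deriv b) \<Theta>"
proof (rule inj_onI)
  fix s t assume "s \<in> \<Theta>" "t \<in> \<Theta>" "deriv b s = deriv b t"
  then show "s = t" using deriv_b_strict_mono[of s t] deriv_b_strict_mono[of t s]
    by (cases s t rule: linorder_cases) auto
qed

lemma param_in_\<Theta>: "u \<in> J \<Longrightarrow> \<tau> u \<in> \<Theta>"
  unfolding mean_space_def param_of_mean_def
  by (rule the_inv_into_into[OF inj_on_deriv_b]) auto

lemma deriv_b_param: "u \<in> J \<Longrightarrow> deriv b (\<tau> u) = u"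
  unfolding mean_space_def param_of_mean_def by (rule f_the_inv_into_f[OF inj_on_deriv_b])

lemma param_mono:
  assumes "u \<in> J" "v \<in> J" "u \<le> v"
  shows "\<tau> u \<le> \<tau> v"
  using deriv_b_strict_mono[of "\<tau> v" "\<tau> u"] assms param_in_\<Theta> deriv_b_param
  by (metis not_less)

lemma is_interval_J: "is_interval J"
  unfolding mean_space_def is_interval_connected_1
  using continuous_on_deriv_b interval_\<Theta> is_interval_connected_1 by (intro connected_continuous_image) auto

lemma J_between:
  assumes "p \<in> J" "q \<in> J" "p \<le> u" "u \<le> q"
  shows "u \<in> J"
  using is_interval_J assms unfolding is_interval_1 by blast

lemma J_borel [measurable]: "J \<in> sets borel"
  using is_interval_J by (rule real_interval_borel_measurable)

text \<open>The slope of \<open>tilt x\<close> at \<open>z\<close> is \<open>x - deriv b z\<close>: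
  its sign gives unimodality, its size limits the decrease away from the mode.\<close>

lemma tilt_mean_value:
  assumes "s \<in> \<Theta>" "t \<in> \<Theta>" "s < t"
  obtains z where "s < z" "z < t" "z \<in> \<Theta>" "tilt x t - tilt x s = (t - s) * (x - deriv b z)"
proof -
  have "(tilt x has_real_derivative x - deriv b z) (at z)" if "s \<le> z" "z \<le> t" for z
    unfolding tilt_def using that in_\<Theta>_between[OF assms(1,2)]
    by (auto intro!: derivative_eq_intros b_has_derivative)
  then obtain z where "s < z" "z < t" "tilt x t - tilt x s = (t - s) * (x - deriv b z)"
    using MVT2[OF \<open>s < t\<close>, of "tilt x" "\<lambda>z. x - deriv b z"] by blast
  then show thesis using that in_\<Theta>_between[OF assms(1,2), of z] by auto
qed

lemma tilt_antimono:
  assumes "x \<in> J" "v \<in> J" "u \<in> J" "x \<le> v" "v \<le> u"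
  shows "tilt x (\<tau> u) \<le> tilt x (\<tau> v)"
proof (cases "\<tau> v < \<tau> u")
  case True
  with assms obtain z where z: "\<tau> v < z" "z \<in> \<Theta>"
      "tilt x (\<tau> u) - tilt x (\<tau> v) = (\<tau> u - \<tau> v) * (x - deriv b z)"
    using tilt_mean_value param_in_\<Theta> by metis
  have "v < deriv b z"
    using deriv_b_strict_mono[OF param_in_\<Theta>[OF assms(2)] z(2,1)] deriv_b_param assms by simp
  then have "(\<tau> u - \<tau> v) * (x - deriv b z) \<le> 0"
    using True assms by (intro mult_nonneg_nonpos) auto
  with z(3) show ?thesis by simp
next
  case False
  then have "\<tau> u = \<tau> v" using param_mono[of v u] assms by auto
  then show ?thesis by simp
qed

text \<open>To the left of the mode the slope \<open>x - deriv b z\<close> is positive; to the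
  right, \<open>tilt_antimono\<close> applies with \<open>v = x\<close>.\<close>

lemma tilt_le_max:
  assumes "x \<in> J" "u \<in> J"
  shows "tilt x (\<tau> u) \<le> tilt x (\<tau> x)"
proof (cases "\<tau> u < \<tau> x")
  case True
  with assms obtain z where z: "z < \<tau> x" "z \<in> \<Theta>"
      "tilt x (\<tau> x) - tilt x (\<tau> u) = (\<tau> x - \<tau> u) * (x - deriv b z)"
    using tilt_mean_value param_in_\<Theta> by metis
  have "deriv b z < x"
    using deriv_b_strict_mono[OF z(2) param_in_\<Theta>[OF assms(1)] z(1)] deriv_b_param assms by simp
  then have "(\<tau> x - \<tau> u) * (x - deriv b z) \<ge> 0"
    using True by (intro mult_nonneg_nonneg) auto
  with z(3) show ?thesis by simp
next
  case False
  show ?thesis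
  proof (cases "x \<le> u")
    case True
    then show ?thesis using tilt_antimono assms by simp
  next
    case False
    then have "\<tau> u = \<tau> x" using \<open>\<not> \<tau> u < \<tau> x\<close> param_mono[of u x] assms by auto
    then show ?thesis by simp
  qed
qed

text \<open>The constant is a lower bound of the second derivative of \<open>b\<close> on the
  compact parameter interval from \<open>\<tau> p\<close> to \<open>\<tau> q\<close>, positive by
  continuity; its reciprocal bounds the slope of the inverse.\<close>

lemma param_lipschitz:
  assumes "p \<in> J" "q \<in> J"
  obtains m where "m > 0"
    "\<And>u v. p \<le> v \<Longrightarrow> v \<le> u \<Longrightarrow> u \<le> q \<Longrightarrow> \<tau> u - \<tau> v \<le> (u - v) / m"
proof -
  have sub: "{\<tau> p..\<tau> q} \<subseteq> \<Theta>"
    using in_\<Theta>_between[OF param_in_\<Theta> param_in_\<Theta>, OF assms] by auto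
  obtain c where c: "c > 0" "\<forall>t\<in>{\<tau> p..\<tau> q}. c \<le> deriv (deriv b) t"
    using continuous_pos_locally_bounded_away_from_zero[OF continuous_on_deriv_deriv_b b_second_deriv_pos]
      sub compact_Icc unfolding locally_bounded_away_from_zero_def by blast
  have "\<tau> u - \<tau> v \<le> (u - v) / c" if le: "p \<le> v" "v \<le> u" "u \<le> q" for u v
  proof (cases "\<tau> v < \<tau> u")
    case True
    have J: "u \<in> J" "v \<in> J" using le J_between[OF assms] by auto
    then have \<tau>: "\<tau> p \<le> \<tau> v" "\<tau> u \<le> \<tau> q" using param_mono assms le by auto
    have "(deriv b has_real_derivative deriv (deriv b) z) (at z)" if "\<tau> v \<le> z" "z \<le> \<tau> u" for z
      using that \<tau> sub by (intro deriv_b_has_derivative) auto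
    then obtain z where z: "\<tau> v < z" "z < \<tau> u"
        "deriv b (\<tau> u) - deriv b (\<tau> v) = (\<tau> u - \<tau> v) * deriv (deriv b) z"
      using MVT2[OF True, of "deriv b" "deriv (deriv b)"] by blast
    have "(\<tau> u - \<tau> v) * c \<le> (\<tau> u - \<tau> v) * deriv (deriv b) z"
      using c(2) z \<tau> True by (intro mult_left_mono) auto
    also have "\<dots> = u - v" using z(3) deriv_b_param J by simp
    finally show ?thesis using c(1) by (simp add: field_simps)
  next
    case False
    then have "\<tau> u - \<tau> v \<le> 0" by simp
    also have "0 \<le> (u - v) / c" using le c(1) by simp
    finally show ?thesis .
  qed
  with c(1) show thesis by (rule that)
qed

text \<open>Between \<open>\<tau> v\<close> and \<open>\<tau> u\<close> the exponent falls at rate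
  at most \<open>u - x\<close>, over a parameter distance of at most \<open>(u - v) / m\<close>. For
  \<open>v = x\<close> the loss is quadratic in \<open>u - x\<close>, otherwise only linear in
  \<open>u - v\<close>; hence the two interval lengths \<open>\<delta> / sqrt n\<close> and
  \<open>\<delta> / n\<close> used below.\<close>

lemma tilt_diff_le:
  assumes "x \<in> J" "v \<in> J" "u \<in> J" "x \<le> v" "v \<le> u"
    and m: "m > 0" "\<tau> u - \<tau> v \<le> (u - v) / m"
  shows "tilt x (\<tau> v) - (u - x) * (u - v) / m \<le> tilt x (\<tau> u)"
proof (cases "\<tau> v < \<tau> u")
  case True
  with assms obtain z where z: "z < \<tau> u" "z \<in> \<Theta>"
      "tilt x (\<tau> u) - tilt x (\<tau> v) = (\<tau> u - \<tau> v) * (x - deriv b z)"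
    using tilt_mean_value param_in_\<Theta> by metis
  have "deriv b z < u"
    using deriv_b_strict_mono[OF z(2) param_in_\<Theta>[OF assms(3)] z(1)] deriv_b_param assms by simp
  then have "(\<tau> u - \<tau> v) * (deriv b z - x) \<le> (\<tau> u - \<tau> v) * (u - x)"
    using True by (intro mult_left_mono) auto
  also have "\<dots> \<le> (u - v) / m * (u - x)"
    using m assms by (intro mult_right_mono) auto
  finally show ?thesis using z(3) by (simp add: algebra_simps)
next
  case False
  then have "\<tau> u = \<tau> v" using param_mono[of v u] assms by auto
  then show ?thesis using assms by simp
qed

text \<open>The log-ratio of the two densities is affine in the observation, so its expectation
  involves only the total mass and the mean, the latter known from \<open>moment_1\<close>.\<close>

lemma mean_divergence_eq:
  assumes "\<mu> \<in> J" "\<mu>' \<in> J"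
  shows "mean_divergence \<Theta> \<xi> b \<mu> \<mu>' = tilt \<mu> (\<tau> \<mu>) - tilt \<mu> (\<tau> \<mu>')"
proof -
  define s t where "s = \<tau> \<mu>" and "t = \<tau> \<mu>'"
  have st: "s \<in> \<Theta>" "t \<in> \<Theta>" and s: "deriv b s = \<mu>"
    using param_in_\<Theta> deriv_b_param assms unfolding s_def t_def by auto
  define g where "g x = exp ((s - t) * x - b s + b t)" for x
  have [measurable]: "(\<lambda>x. exp (r * x - b r)) \<in> borel_measurable \<xi>" "g \<in> borel_measurable \<xi>" for r
    unfolding g_def by (auto intro!: borel_measurable_\<xi>)
  interpret T: prob_space "exp_fam \<xi> b t" by (rule prob_exp_fam[OF st(2)])
  \<comment> \<open>The divergence is computed with the member at \<open>t\<close> as reference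
    measure, so the member at \<open>s\<close> is rewritten as a density over it.\<close>
  have eq: "exp_fam \<xi> b s = density (exp_fam \<xi> b t) (\<lambda>x. ennreal (g x))"
  proof -
    have "density (exp_fam \<xi> b t) (\<lambda>x. ennreal (g x))
        = density \<xi> (\<lambda>x. ennreal (exp (t * x - b t)) * ennreal (g x))"
      unfolding exp_fam_def by (rule density_density_eq) measurable
    also have "\<dots> = exp_fam \<xi> b s"
      unfolding exp_fam_def
      by (intro arg_cong[where f = "density \<xi>"] ext)
         (simp add: g_def ennreal_mult[symmetric] exp_add[symmetric] algebra_simps)
    finally show ?thesis by simp
  qed
  have "mean_divergence \<Theta> \<xi> b \<mu> \<mu>' = (\<integral>x. g x * log (exp 1) (g x) \<partial>exp_fam \<xi> b t)"
    unfolding mean_divergence_def exp_fam_mean_def s_def[symmetric] t_def[symmetric] eq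
    by (rule T.KL_density) (auto simp: g_def exp_fam_def intro!: borel_measurable_\<xi>)
  also have "\<dots> = (\<integral>x. exp (t * x - b t) * (g x * ((s - t) * x - b s + b t)) \<partial>\<xi>)"
    unfolding exp_fam_def
    by (subst integral_real_density)
       (auto simp: g_def log_def intro!: borel_measurable_\<xi>)
  \<comment> \<open>A linear combination of the integrand of \<open>moment 1 s\<close> and a density
    of total mass 1.\<close>
  also have "\<dots> = (\<integral>x. exp (- b s) * (s - t) * (x ^ 1 * exp (s * x))
      + (b t - b s) * exp (s * x - b s) \<partial>\<xi>)"
  proof (intro Bochner_Integration.integral_cong refl)
    fix x
    have "exp (t * x - b t) * g x = exp (s * x - b s)"
      unfolding g_def exp_add[symmetric] by (simp add: algebra_simps)
    moreover have "exp (s * x - b s) = exp (- b s) * exp (s * x)"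
      by (simp add: exp_add[symmetric])
    ultimately show "exp (t * x - b t) * (g x * ((s - t) * x - b s + b t)) =
        exp (- b s) * (s - t) * (x ^ 1 * exp (s * x)) + (b t - b s) * exp (s * x - b s)"
      by (simp add: mult.assoc[symmetric]) (simp add: algebra_simps)
  qed
  also have "\<dots> = exp (- b s) * (s - t) * moment 1 s + (b t - b s)"
    using moment_integrable[OF st(1), of 1] density_has_integral[OF st(1)]
    unfolding moment_def by simp
  also have "\<dots> = (s - t) * \<mu> + (b t - b s)"
    using moment_1[OF st(1)] s by (simp add: exp_minus)
  finally show ?thesis unfolding tilt_def s_def t_def by (simp add: algebra_simps)
qed

text \<open>On \<open>J\<close> the map \<tau> is monotone, hence measurable. The indicator masks
  its unspecified values outside \<open>J\<close>.\<close>

lemma borel_measurable_exp_tilt: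
  "(\<lambda>u. indicator J u * exp (real n * tilt x (\<tau> u))) \<in> borel_measurable borel"
proof -
  have "\<tau> \<in> borel_measurable (restrict_space borel J)"
    using param_mono by (intro borel_measurable_mono_on_fnc) (auto simp: mono_on_def)
  then have \<tau>: "\<tau> \<in> restrict_space borel J \<rightarrow>\<^sub>M restrict_space borel \<Theta>"
    using param_in_\<Theta> by (intro measurable_restrict_space2) (auto simp: space_restrict_space)
  have "(\<lambda>t. exp (real n * tilt x t)) \<in> borel_measurable (restrict_space borel \<Theta>)"
    unfolding tilt_def
    by (intro borel_measurable_continuous_on_restrict continuous_intros continuous_on_b)
  from measurable_compose[OF \<tau> this] show ?thesis
    by (subst (asm) borel_measurable_restrict_space_iff) (auto simp: scaleR_conv_of_real mult_ac)
qed

subsection \<open>Posterior tail bounds\<close>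

context
  fixes f :: "real \<Rightarrow> real" and n :: nat and x :: real
  assumes f: "prob_density_on J f" and x: "x \<in> J"
begin

abbreviation "w \<equiv> posterior_weight \<Theta> b f n x"

lemma posterior_weight_eq: "w u = exp (real n * tilt x (\<tau> u)) * f u"
  unfolding posterior_weight_def tilt_def by simp

lemma posterior_weight_nonneg: "u \<in> J \<Longrightarrow> 0 \<le> w u"
  using f by (simp add: posterior_weight_eq prob_density_on_def)

lemma posterior_weight_le:
  assumes "u \<in> J" "tilt x (\<tau> u) \<le> M"
  shows "w u \<le> exp (real n * M) * f u"
  using assms f unfolding posterior_weight_eq prob_density_on_def
  by (intro mult_right_mono) (auto intro!: mult_left_mono)

lemma posterior_weight_set_integrable: "set_integrable lborel J w"
proof -
  have int: "set_integrable lborel J f" using f by (simp add: prob_density_on_def)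
  have meas: "set_borel_measurable lborel J w"
  proof -
    have "(\<lambda>u. indicator J u * f u) \<in> borel_measurable borel"
      using int unfolding set_integrable_def by auto
    \<comment> \<open>Each factor is known to be measurable only after cutting off to
      \<open>J\<close>; the doubled indicator collapses to a single one.\<close>
    then have "(\<lambda>u. (indicator J u * exp (real n * tilt x (\<tau> u))) * (indicator J u * f u))
        \<in> borel_measurable borel"
      by (rule borel_measurable_times[OF borel_measurable_exp_tilt])
    also have "(\<lambda>u. (indicator J u * exp (real n * tilt x (\<tau> u))) * (indicator J u * f u))
        = (\<lambda>u. indicator J u *\<^sub>R w u)"
      by (auto simp: posterior_weight_eq fun_eq_iff indicator_def)
    finally show ?thesis unfolding set_borel_measurable_def by simp
  qed
  show ?thesis
  proof (rule set_integrable_bound[of _ _ "\<lambda>u. exp (real n * tilt x (\<tau> x)) * f u", OF _ meas])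
    show "set_integrable lborel J (\<lambda>u. exp (real n * tilt x (\<tau> x)) * f u)"
      using int by (intro set_integrable_mult_right)
    show "AE u in lborel. u \<in> J \<longrightarrow> norm (w u) \<le> norm (exp (real n * tilt x (\<tau> x)) * f u)"
    proof (intro AE_I2 impI)
      fix u assume u: "u \<in> J"
      have "w u \<le> exp (real n * tilt x (\<tau> x)) * f u" using posterior_weight_le[OF u tilt_le_max[OF x u]] .
      with posterior_weight_nonneg[OF u] show "norm (w u) \<le> norm (exp (real n * tilt x (\<tau> x)) * f u)" by simp
    qed
  qed
qed

text \<open>The exponential factor is at most \<open>exp (real n * M)\<close> on \<open>S\<close>,
  and the prior mass of \<open>S\<close> is at most 1.\<close>

lemma posterior_weight_integral_le:
  assumes S: "S \<in> sets borel" "S \<subseteq> J" and M: "\<And>u. u \<in> S \<Longrightarrow> tilt x (\<tau> u) \<le> M"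
  shows "(LINT u:S|lborel. w u) \<le> exp (real n * M)"
proof -
  have int: "set_integrable lborel J f" and one: "(LINT u:J|lborel. f u) = 1"
    and nn: "\<And>u. u \<in> J \<Longrightarrow> 0 \<le> f u"
    using f by (auto simp: prob_density_on_def)
  have intS: "set_integrable lborel S f" using set_integrable_subset[OF int] S by simp
  have "(LINT u:S|lborel. w u) \<le> (LINT u:S|lborel. exp (real n * M) * f u)"
    using posterior_weight_le M S set_integrable_subset[OF posterior_weight_set_integrable] intS
    by (intro set_integral_mono) auto
  also have "\<dots> = exp (real n * M) * (LINT u:S|lborel. f u)" by simp
  also have "(LINT u:S|lborel. f u) \<le> (LINT u:J|lborel. f u)"
    using nn S by (intro set_integral_mono_superset[OF intS int]) auto
  then have "exp (real n * M) * (LINT u:S|lborel. f u) \<le> exp (real n * M)"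
    using one by simp
  finally show ?thesis .
qed

text \<open>Only the part of the integral over \<open>{v..v + r}\<close> is kept, where prior and
  exponent have constant lower bounds.\<close>

lemma posterior_weight_integral_ge:
  assumes S: "S \<in> sets borel" "S \<subseteq> J" "{v..v + r} \<subseteq> S" and "r \<ge> 0" "c \<ge> 0"
    and c: "\<And>u. u \<in> {v..v + r} \<Longrightarrow> c \<le> f u"
    and L: "\<And>u. u \<in> {v..v + r} \<Longrightarrow> L \<le> tilt x (\<tau> u)"
  shows "c * r * exp (real n * L) \<le> (LINT u:S|lborel. w u)"
proof -
  have intS: "set_integrable lborel S w"
    using set_integrable_subset[OF posterior_weight_set_integrable] S by simp
  have intI: "set_integrable lborel {v..v + r} w"
    using set_integrable_subset[OF intS] S by simp
  have "c * r * exp (real n * L) = (LINT u:{v..v + r}|lborel. exp (real n * L) * c)"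
    using \<open>r \<ge> 0\<close> by (subst set_integral_const) auto
  also have "\<dots> \<le> (LINT u:{v..v + r}|lborel. w u)"
  proof (rule set_integral_mono[OF _ intI])
    show "set_integrable lborel {v..v + r} (\<lambda>u. exp (real n * L) * c)"
      by (rule borel_integrable_atLeastAtMost') simp
    show "exp (real n * L) * c \<le> w u" if "u \<in> {v..v + r}" for u
      unfolding posterior_weight_eq using L[OF that] c[OF that] \<open>c \<ge> 0\<close>
      by (intro mult_mono) (auto intro!: mult_left_mono)
  qed
  also have "\<dots> \<le> (LINT u:S|lborel. w u)"
    using posterior_weight_nonneg S by (intro set_integral_mono_superset[OF intI intS]) auto
  finally show ?thesis .
qed

text \<open>Positivity of the normalizer is not established at this point; if it were 0, both sides
  would be 0 because division by 0 yields 0.\<close>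

lemma measure_posterior:
  assumes S: "S \<in> sets borel"
  shows "measure (posterior \<Theta> b f n x) S = (LINT u:J \<inter> S|lborel. w u) / (LINT u:J|lborel. w u)"
proof -
  define D where "D = (LINT u:J|lborel. w u)"
  have D: "D \<ge> 0"
    unfolding D_def set_lebesgue_integral_def using posterior_weight_nonneg
    by (intro Bochner_Integration.integral_nonneg) (auto simp: indicator_def)
  have int: "integrable lborel (\<lambda>u. indicator (J \<inter> S) u *\<^sub>R w u)"
    using set_integrable_subset[OF posterior_weight_set_integrable, of "J \<inter> S"] S unfolding set_integrable_def by simp
  have nn: "0 \<le> indicator (J \<inter> S) u *\<^sub>R w u / D" for u
    using posterior_weight_nonneg D by (auto simp: indicator_def)
  have [measurable]: "(\<lambda>u. indicator J u * w u) \<in> borel_measurable borel"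
    using posterior_weight_set_integrable unfolding set_integrable_def by auto
  have meas: "(\<lambda>u. indicator J u * ennreal (w u / D)) \<in> borel_measurable lborel"
  proof -
    have "(\<lambda>u. indicator J u * ennreal (w u / D)) = (\<lambda>u. ennreal (indicator J u * w u / D))"
      by (auto simp: fun_eq_iff indicator_def)
    then show ?thesis by simp
  qed
  have "emeasure (posterior \<Theta> b f n x) S
      = (\<integral>\<^sup>+u. indicator J u * ennreal (w u / D) * indicator S u \<partial>lborel)"
    unfolding posterior_def D_def[symmetric] using S meas by (simp add: emeasure_density)
  also have "\<dots> = (\<integral>\<^sup>+u. ennreal (indicator (J \<inter> S) u *\<^sub>R w u / D) \<partial>lborel)"
    by (intro nn_integral_cong) (auto simp: indicator_def)
  also have "\<dots> = ennreal (\<integral>u. indicator (J \<inter> S) u *\<^sub>R w u / D \<partial>lborel)"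
    using int nn by (intro nn_integral_eq_integral) auto
  finally have "measure (posterior \<Theta> b f n x) S = (\<integral>u. indicator (J \<inter> S) u *\<^sub>R w u / D \<partial>lborel)"
    unfolding measure_def using nn
    by (simp only: enn2real_ennreal Bochner_Integration.integral_nonneg)
  then show ?thesis
    unfolding set_lebesgue_integral_def D_def[unfolded set_lebesgue_integral_def] by simp
qed

end

section \<open>Normalizer and tail estimates with explicit constants\<close>

context
  fixes p q m \<delta> c x :: real and f :: "real \<Rightarrow> real" and n :: nat
  assumes pq: "p \<in> J" "q \<in> J" and pos: "0 < m" "0 < \<delta>" "0 < c"
    and lip: "\<And>u v. p \<le> v \<Longrightarrow> v \<le> u \<Longrightarrow> u \<le> q \<Longrightarrow> \<tau> u - \<tau> v \<le> (u - v) / m"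
    and f: "prob_density_on J f" and c: "\<And>u. u \<in> {p..q} \<Longrightarrow> c \<le> f u"
    and x: "p \<le> x" "x + \<delta> \<le> q" and n: "n \<ge> 1"
begin

lemma in_J: "p \<le> u \<Longrightarrow> u \<le> q \<Longrightarrow> u \<in> J"
  using J_between[OF pq] by blast

lemma x_in_J: "x \<in> J"
  using in_J[of x] x pos by simp

text \<open>On an interval of length \<open>\<delta> / sqrt n\<close> to the right of \<open>x\<close>, the exponent
  \<open>n * tilt x (\<tau> u)\<close> stays within \<open>\<delta>\<^sup>2 / m\<close> of its maximum.\<close>

lemma near_mode_integral_ge:
  assumes S: "S \<in> sets borel" "S \<subseteq> J" "{x..q} \<subseteq> S"
  shows "c * \<delta> * exp (- \<delta>\<^sup>2 / m) / sqrt n * exp (real n * tilt x (\<tau> x))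
    \<le> (LINT u:S|lborel. posterior_weight \<Theta> b f n x u)"
proof -
  define r where "r = \<delta> / sqrt n"
  have r: "0 < r" "r \<le> \<delta>" "real n * r\<^sup>2 = \<delta>\<^sup>2"
    using pos n by (auto simp: r_def power_divide field_simps)
  have "c * r * exp (real n * (tilt x (\<tau> x) - r\<^sup>2 / m))
      \<le> (LINT u:S|lborel. posterior_weight \<Theta> b f n x u)"
  proof (rule posterior_weight_integral_ge[OF f x_in_J S(1,2), of x r])
    show "{x..x + r} \<subseteq> S" using S(3) r x by auto
    show "c \<le> f u" if "u \<in> {x..x + r}" for u
      using that r x by (intro c) auto
    show "tilt x (\<tau> x) - r\<^sup>2 / m \<le> tilt x (\<tau> u)" if u: "u \<in> {x..x + r}" for u
    proof -
      \<comment> \<open>\<open>tilt_diff_le\<close> with \<open>v = x\<close>: both factors of the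
        loss are at most \<open>r\<close>.\<close>
      have "tilt x (\<tau> x) - (u - x) * (u - x) / m \<le> tilt x (\<tau> u)"
        using u x r pos by (intro tilt_diff_le x_in_J in_J lip) auto
      moreover have "(u - x) * (u - x) / m \<le> r\<^sup>2 / m"
        unfolding power2_eq_square using u pos r by (intro divide_right_mono mult_mono) auto
      ultimately show ?thesis by linarith
    qed
  qed (use pos r in auto)
  also have "real n * (tilt x (\<tau> x) - r\<^sup>2 / m) = - \<delta>\<^sup>2 / m + real n * tilt x (\<tau> x)"
    using r(3) by (simp add: right_diff_distrib)
  finally show ?thesis unfolding r_def exp_add by (simp add: mult_ac)
qed

text \<open>The lower bound is the near-mode estimate with \<open>S = J\<close>; its
  \<open>1 / sqrt n\<close> becomes the \<open>sqrt n\<close> of the upper tail bound. The upper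
  bound serves both lower tail bounds.\<close>

lemma normalizer_bounds:
  defines "D \<equiv> (LINT u:J|lborel. posterior_weight \<Theta> b f n x u)"
  shows "0 < D" "c * \<delta> * exp (- \<delta>\<^sup>2 / m) / sqrt n * exp (real n * tilt x (\<tau> x)) \<le> D"
    "D \<le> exp (real n * tilt x (\<tau> x))"
proof -
  show *: "c * \<delta> * exp (- \<delta>\<^sup>2 / m) / sqrt n * exp (real n * tilt x (\<tau> x)) \<le> D"
    unfolding D_def using in_J x by (intro near_mode_integral_ge) auto
  have "0 < c * \<delta> * exp (- \<delta>\<^sup>2 / m) / sqrt n * exp (real n * tilt x (\<tau> x))"
    using pos n by (intro mult_pos_pos divide_pos_pos) auto
  with * show "0 < D" by linarith
  show "D \<le> exp (real n * tilt x (\<tau> x))"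
    unfolding D_def using tilt_le_max[OF x_in_J] by (intro posterior_weight_integral_le[OF f x_in_J]) auto
qed

lemma exp_mean_divergence:
  assumes "v \<in> J"
  shows "exp (- real n * mean_divergence \<Theta> \<xi> b x v)
    = exp (real n * tilt x (\<tau> v)) / exp (real n * tilt x (\<tau> x))"
  unfolding mean_divergence_eq[OF x_in_J assms]
  by (simp add: exp_diff[symmetric] algebra_simps)

context
  fixes v :: real and T :: "real set"
  assumes v: "p \<le> v" "v + \<delta> \<le> q" and T: "T \<in> sets borel" "{v..q} \<subseteq> T" "T \<subseteq> {v..}"
begin

lemma v_in_J: "v \<in> J"
  using in_J[of v] v pos by simp

text \<open>Beyond \<open>v\<close> the exponent is at most its value at \<open>v\<close>, which
  bounds the numerator; dividing by the lower bound of the normalizer leaves the ratio of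
  \<open>exp_mean_divergence\<close>.\<close>

lemma posterior_tail_upper:
  assumes "x \<le> v"
  shows "measure (posterior \<Theta> b f n x) T
    \<le> 1 / (c * \<delta> * exp (- \<delta>\<^sup>2 / m)) * sqrt n * exp (- real n * mean_divergence \<Theta> \<xi> b x v)"
proof -
  define k where "k = c * \<delta> * exp (- \<delta>\<^sup>2 / m)"
  have k: "k > 0" using pos by (simp add: k_def)
  have "(LINT u:J \<inter> T|lborel. posterior_weight \<Theta> b f n x u) \<le> exp (real n * tilt x (\<tau> v))"
    using assms T v_in_J x_in_J by (intro posterior_weight_integral_le[OF f x_in_J] tilt_antimono) auto
  then have "measure (posterior \<Theta> b f n x) T
      \<le> exp (real n * tilt x (\<tau> v)) / (k / sqrt n * exp (real n * tilt x (\<tau> x)))"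
    unfolding measure_posterior[OF f x_in_J T(1)] k_def
    using normalizer_bounds pos n by (intro frac_le) (auto intro!: mult_pos_pos divide_pos_pos)
  then show ?thesis
    unfolding exp_mean_divergence[OF v_in_J] k_def[symmetric] using k n by (simp add: field_simps)
qed

text \<open>The tail starts beyond the mode, where the exponent may fall linearly. Length
  \<open>\<delta> / n\<close> keeps the total loss \<open>n * (q - p) * r / m\<close> equal to the
  constant \<open>(q - p) * \<delta> / m\<close>.\<close>

lemma posterior_tail_lower:
  assumes "x \<le> v"
  shows "c * \<delta> * exp (- (q - p) * \<delta> / m) * inverse n * exp (- real n * mean_divergence \<Theta> \<xi> b x v)
    \<le> measure (posterior \<Theta> b f n x) T"
proof -
  define r where "r = \<delta> / n"
  have r: "0 < r" "r \<le> \<delta>" "real n * r = \<delta>"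
    using pos n by (auto simp: r_def field_simps)
  have num: "c * r * exp (real n * (tilt x (\<tau> v) - (q - p) * r / m))
      \<le> (LINT u:J \<inter> T|lborel. posterior_weight \<Theta> b f n x u)"
  proof (rule posterior_weight_integral_ge[OF f x_in_J, of _ v r])
    show "{v..v + r} \<subseteq> J \<inter> T" using T(2) r(1,2) v in_J by auto
    show "c \<le> f u" if "u \<in> {v..v + r}" for u
      using that r v by (intro c) auto
    show "tilt x (\<tau> v) - (q - p) * r / m \<le> tilt x (\<tau> u)" if u: "u \<in> {v..v + r}" for u
    proof -
      have "tilt x (\<tau> v) - (u - x) * (u - v) / m \<le> tilt x (\<tau> u)"
        using u v r pos assms by (intro tilt_diff_le x_in_J v_in_J in_J lip) auto
      moreover have "(u - x) * (u - v) / m \<le> (q - p) * r / m"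
        using u pos r x v assms by (intro divide_right_mono mult_mono) auto
      ultimately show ?thesis by linarith
    qed
  qed (use pos r T in auto)
  have "real n * (tilt x (\<tau> v) - (q - p) * r / m)
      = - (q - p) * \<delta> / m + real n * tilt x (\<tau> v)"
    unfolding r(3)[symmetric] using pos(1) by (simp add: field_simps)
  then have "c * \<delta> * exp (- (q - p) * \<delta> / m) * inverse n * exp (real n * tilt x (\<tau> v))
      = c * r * exp (real n * (tilt x (\<tau> v) - (q - p) * r / m))"
    by (simp only: exp_add) (simp add: r_def field_simps)
  \<comment> \<open>Besides bounding the numerator, \<open>num\<close> supplies the nonnegativity
    that \<open>frac_le\<close> asks of it.\<close>
  moreover have "c * r * exp (real n * (tilt x (\<tau> v) - (q - p) * r / m))
        / exp (real n * tilt x (\<tau> x))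
      \<le> measure (posterior \<Theta> b f n x) T"
    unfolding measure_posterior[OF f x_in_J T(1)]
    using num normalizer_bounds pos r by (intro frac_le order_trans[OF _ num]) auto
  ultimately show ?thesis
    unfolding exp_mean_divergence[OF v_in_J] by (simp only: times_divide_eq_right)
qed

text \<open>Here the tail contains \<open>{x..q}\<close>, so the near-mode estimate applies to the
  numerator itself, and its exponential factor cancels against the upper bound of the
  normalizer.\<close>

lemma posterior_tail_lower_below:
  assumes "v \<le> x"
  shows "c * \<delta> * exp (- \<delta>\<^sup>2 / m) / sqrt n \<le> measure (posterior \<Theta> b f n x) T"
proof -
  define k where "k = c * \<delta> * exp (- \<delta>\<^sup>2 / m) / sqrt n"
  define E where "E = exp (real n * tilt x (\<tau> x))"
  have num: "k * E \<le> (LINT u:J \<inter> T|lborel. posterior_weight \<Theta> b f n x u)"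
    unfolding k_def E_def using T assms in_J x by (intro near_mode_integral_ge) auto
  have k: "0 \<le> k" "0 < E" using pos by (auto simp: k_def E_def)
  have "k * E / E \<le> measure (posterior \<Theta> b f n x) T"
    unfolding measure_posterior[OF f x_in_J T(1)]
    using num normalizer_bounds k by (intro frac_le order_trans[OF _ num]) (auto simp: E_def)
  then show ?thesis using k unfolding k_def by simp
qed

end

end

end

section \<open>Constants uniform in the arm, and the final bounds\<close>

theorem lemma4:
  fixes \<Theta> :: "real set" and \<xi> :: "real measure" and b :: "real \<Rightarrow> real"
    and K :: nat and f :: "nat \<Rightarrow> real \<Rightarrow> real" and \<mu>0m \<mu>0p :: real
  assumes "exponential_family \<Theta> \<xi> b"
    and "\<And>a. a \<in> {1..K} \<Longrightarrow> prob_density_on (mean_space \<Theta> b) (f a)"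
    and "\<And>a u. a \<in> {1..K} \<Longrightarrow> u \<in> mean_space \<Theta> b \<Longrightarrow> f a u > 0"
    and "\<And>a. a \<in> {1..K} \<Longrightarrow> locally_bounded_away_from_zero (mean_space \<Theta> b) (f a)"
    and "mean_inf \<Theta> b < ereal \<mu>0m" and "\<mu>0m < \<mu>0p" and "ereal \<mu>0p < mean_sup \<Theta> b"
  shows "(\<exists>A>0. \<exists>B>0. \<forall>(x::real) (v::real) (n::nat). \<forall>a\<in>{1..K}.
            \<mu>0m < x \<and> x < v \<and> v < \<mu>0p \<and> n \<ge> 1 \<longrightarrow>
              A * inverse (real n) * exp (- real n * mean_divergence \<Theta> \<xi> b x v)
                \<le> measure (posterior \<Theta> b (f a) n x) {u. v \<le> u \<and> ereal u < mean_sup \<Theta> b} \<and>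
              measure (posterior \<Theta> b (f a) n x) {u. v \<le> u \<and> ereal u < mean_sup \<Theta> b}
                \<le> B * sqrt (real n) * exp (- real n * mean_divergence \<Theta> \<xi> b x v)) \<and>
         (\<exists>C>0. \<forall>(x::real) (v::real) (n::nat). \<forall>a\<in>{1..K}.
            \<mu>0m < v \<and> v \<le> x \<and> x < \<mu>0p \<and> n \<ge> 1 \<longrightarrow>
              measure (posterior \<Theta> b (f a) n x) {u. v \<le> u \<and> ereal u < mean_sup \<Theta> b}
                \<ge> C / sqrt (real n))"
proof -
  interpret exponential_family \<Theta> \<xi> b by fact
  \<comment> \<open>\<open>{p..q}\<close> will be the compact piece of the mean space on which the
    Lipschitz and prior bounds are taken.\<close>
  obtain p where p: "p \<in> mean_space \<Theta> b" "p < \<mu>0m"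
    using assms(5) unfolding mean_inf_def INF_less_iff by auto
  obtain q' where q': "q' \<in> mean_space \<Theta> b" "\<mu>0p < q'"
    using assms(7) unfolding mean_sup_def less_SUP_iff by auto
  \<comment> \<open>Moving back from \<open>q'\<close> makes \<open>q\<close> strictly smaller than
    \<open>mean_sup \<Theta> b\<close>, so that \<open>{v..q}\<close> lies inside the tail
    set.\<close>
  obtain q where q: "\<mu>0p < q" "q < q'" using dense[OF q'(2)] by blast
  have qJ: "q \<in> mean_space \<Theta> b"
    using J_between[OF p(1) q'(1)] p q assms(6) by simp
  have "ereal q < ereal q'" using q by simp
  also have "\<dots> \<le> mean_sup \<Theta> b" unfolding mean_sup_def using q'(1) by (rule SUP_upper)
  finally have q_sup: "ereal q < mean_sup \<Theta> b" .
  \<comment> \<open>Every point below \<open>\<mu>0p\<close> has room \<delta> to its right within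
    \<open>{p..q}\<close>.\<close>
  define \<delta> where "\<delta> = q - \<mu>0p"
  have \<delta>: "\<delta> > 0" using q by (simp add: \<delta>_def)
  obtain m where m: "m > 0" and lip: "\<And>u v. p \<le> v \<Longrightarrow> v \<le> u \<Longrightarrow> u \<le> q \<Longrightarrow>
      param_of_mean \<Theta> b u - param_of_mean \<Theta> b v \<le> (u - v) / m"
    using param_lipschitz[OF p(1) qJ] by metis
  have "{p..q} \<subseteq> mean_space \<Theta> b" using J_between[OF p(1) qJ] by auto
  then have "\<exists>c>0. \<forall>u\<in>{p..q}. c \<le> f a u" if "a \<in> {1..K}" for a
    using assms(4)[OF that] compact_Icc unfolding locally_bounded_away_from_zero_def by blast
  then obtain c where c: "c > 0" "\<And>a u. a \<in> {1..K} \<Longrightarrow> u \<in> {p..q} \<Longrightarrow> c \<le> f a u"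
    using finite_uniform_pos_lower_bound[of "{1..K}" "{p..q}" f] by auto
  \<comment> \<open>The tail enters the estimates only through
    \<open>{v..q} \<subseteq> T v \<subseteq> {v..}\<close> and measurability, whether or not the
    supremum is finite.\<close>
  define T where "T v = {u. v \<le> u \<and> ereal u < mean_sup \<Theta> b}" for v
  have T: "T v \<in> sets borel" "T v \<subseteq> {v..}" for v
    unfolding T_def by auto
  have T': "{v..q} \<subseteq> T v" for v
    unfolding T_def using q_sup by (auto intro: le_less_trans[of _ "ereal q"])
  \<comment> \<open>\<open>A\<close> carries the linear loss beyond the mode and \<open>C\<close>
    the quadratic loss at it. The constant \<open>B\<close> is \<open>1 / C\<close>, since the
    near-mode estimate bounds the normalizer from below.\<close>
  define A where "A = c * \<delta> * exp (- (q - p) * \<delta> / m)"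
  define C where "C = c * \<delta> * exp (- \<delta>\<^sup>2 / m)"
  have AC: "A > 0" "C > 0" using c(1) \<delta> by (auto simp: A_def C_def)
  have upper_part: "A * inverse n * exp (- real n * mean_divergence \<Theta> \<xi> b x v)
      \<le> measure (posterior \<Theta> b (f a) n x) (T v) \<and>
    measure (posterior \<Theta> b (f a) n x) (T v)
      \<le> 1 / C * sqrt n * exp (- real n * mean_divergence \<Theta> \<xi> b x v)"
    if a: "a \<in> {1..K}" and "\<mu>0m < x \<and> x < v \<and> v < \<mu>0p \<and> n \<ge> 1" for x v n a
  proof -
    have xv: "p \<le> x" "x + \<delta> \<le> q" "n \<ge> 1" "p \<le> v" "v + \<delta> \<le> q" "x \<le> v"
      using that p by (auto simp: \<delta>_def)
    show ?thesis
      unfolding A_def C_def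
      by (intro conjI
        posterior_tail_lower[OF p(1) qJ m \<delta> c(1) _ assms(2)[OF a] _ xv(1-5) T(1) T' T(2) xv(6)]
        posterior_tail_upper[OF p(1) qJ m \<delta> c(1) _ assms(2)[OF a] _ xv(1-5) T(1) T' T(2) xv(6)])
        (auto intro: lip c(2)[OF a])
  qed
  have lower_part: "C / sqrt n \<le> measure (posterior \<Theta> b (f a) n x) (T v)"
    if a: "a \<in> {1..K}" and "\<mu>0m < v \<and> v \<le> x \<and> x < \<mu>0p \<and> n \<ge> 1" for x v n a
  proof -
    have xv: "p \<le> x" "x + \<delta> \<le> q" "n \<ge> 1" "p \<le> v" "v + \<delta> \<le> q" "v \<le> x"
      using that p by (auto simp: \<delta>_def)
    show ?thesis
      unfolding C_def
      by (intro posterior_tail_lower_below[OF p(1) qJ m \<delta> c(1) _ assms(2)[OF a] _ xv(1-5) T(1) T' T(2) xv(6)])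
        (auto intro: lip c(2)[OF a])
  qed
  show ?thesis
    unfolding T_def[symmetric]
    using AC upper_part lower_part by (intro conjI exI[of _ A] exI[of _ "1 / C"] exI[of _ C]) auto
qed

end
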